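(* On a right-c.e. quasi-metric space $(X,d,S)$, the Cauchy representation $\delta_C$ is computably equivalent to the standard representation $\delta_S$ of the induced effective topological space.
   Context: A quasi-metric on a set $X$ is $d:X\times X\to\mathbb{R}_{\ge0}$ with $d(x,z)\le d(x,y)+d(y,z)$ and $x=y$ iff $d(x,y)=d(y,x)=0$; it induces the metric $\hat d(x,y)=\max(d(x,y),d(y,x))$. A real is right-c.e. if it equals $\inf_i q_i$ for a computable sequence of rationals. A right-c.e. quasi-metric space is a triple $(X,d,S)$ with $d$ a quasi-metric on $X$ and $S=(s_i)_{i\in\mathbb{N}}$ a $\hat d$-dense sequence such that the numbers $d(s_i,s_j)$ are uniformly right-c.e. It is an effective topological space with basis the balls $B(s_i,r)=\{x: d(s_i,x)<r\}$, $i\in\mathbb{N}$, $r$ a positive rational (effectively numbered). Its standard representation $\delta_S:\subseteq\mathbb{N}^{\mathbb{N}}\to X$: $p$ is a name of $x$ iff $\{n:\exists i\,p(i)=n+1\}$ equals the set of indices of basic balls containing $x$. The Cauchy representation $\delta_C$: $p$ is a name of $x$ iff the sequence $t_n=s_{p(n)}$ satisfies $d(t_n,t_{n+1})<2^{-n}$ for all $n$ and $t_n\to x$ in $\hat d$. Two representations $\delta,\delta'$ are computably equivalent if there are partial computable $F,G:\subseteq\mathbb{N}^{\mathbb{N}}\to\mathbb{N}^{\mathbb{N}}$ with $\delta=\delta'\circ F$ and $\delta'=\delta\circ G$ on the respective domains. *)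

theory Defs
  imports Complex_Main "HOL-Library.Nat_Bijection"
begin

section \<open>Computability on the natural numbers and on Baire space\<close>

text \<open>Unary partial recursive functions relative to an oracle \<open>p\<close>. Several arguments are packed
  with the Cantor pairing \<^const>\<open>prod_encode\<close>, whose two projections are basic functions.\<close>

datatype prog =
    Zero | Succ | Proj1 | Proj2 | Oracle
  | Tuple prog prog
  | Comp prog prog
  | PrimRec prog prog
  | Mu prog

definition minimise :: "(nat \<Rightarrow> nat option) \<Rightarrow> nat option" where
  "minimise g =
     (if \<exists>n. g n = Some 0 \<and> (\<forall>m<n. \<exists>v. g m = Some (Suc v))
      then Some (LEAST n. g n = Some 0) else None)"

primrec run :: "prog \<Rightarrow> (nat \<Rightarrow> nat) \<Rightarrow> nat \<Rightarrow> nat option" where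
  "run Zero p x = Some 0"
| "run Succ p x = Some (Suc x)"
| "run Proj1 p x = Some (fst (prod_decode x))"
| "run Proj2 p x = Some (snd (prod_decode x))"
| "run Oracle p x = Some (p x)"
| "run (Tuple f g) p x =
     Option.bind (run f p x) (\<lambda>a. Option.bind (run g p x) (\<lambda>b. Some (prod_encode (a, b))))"
| "run (Comp f g) p x = Option.bind (run g p x) (run f p)"
| "run (PrimRec f g) p x =
     (case prod_decode x of (a, n) \<Rightarrow>
        rec_nat (run f p a)
          (\<lambda>m r. Option.bind r (\<lambda>v. run g p (prod_encode (a, prod_encode (m, v))))) n)"
| "run (Mu f) p x = minimise (\<lambda>n. run f p (prod_encode (x, n)))"

text \<open>A total function is computable (without oracle) iff some program computes it whatever the
  oracle is.\<close>

definition computable :: "(nat \<Rightarrow> nat) \<Rightarrow> bool" where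
  "computable f \<longleftrightarrow> (\<exists>e. \<forall>p n. run e p n = Some (f n))"

text \<open>The domain of a partial computable map on Baire space consists of those \<open>p\<close> from which the
  program produces an entire output sequence.\<close>

definition partial_computable :: "((nat \<Rightarrow> nat) \<rightharpoonup> (nat \<Rightarrow> nat)) \<Rightarrow> bool" where
  "partial_computable F \<longleftrightarrow>
     (\<exists>e. \<forall>p. F p = (if \<forall>n. run e p n \<noteq> None then Some (\<lambda>n. the (run e p n)) else None))"


section \<open>Right-c.e. numbers\<close>

definition rat_of_code :: "nat \<Rightarrow> rat" where
  "rat_of_code n = (case prod_decode n of (a, b) \<Rightarrow> of_int (int_decode a) / of_nat (Suc b))"

definition pos_rat_of_code :: "nat \<Rightarrow> rat" where
  "pos_rat_of_code n = (case prod_decode n of (a, b) \<Rightarrow> of_nat (Suc a) / of_nat (Suc b))"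

text \<open>\<^const>\<open>Inf\<close> on the reals is meaningful only for sets bounded below.\<close>

definition uniformly_right_ce :: "(nat \<Rightarrow> nat \<Rightarrow> real) \<Rightarrow> bool" where
  "uniformly_right_ce a \<longleftrightarrow>
     (\<exists>f. computable f \<and>
        (\<forall>i j. let q = (\<lambda>k. real_of_rat (rat_of_code (f (prod_encode (i, prod_encode (j, k))))))
               in bdd_below (range q) \<and> a i j = (INF k. q k)))"


section \<open>Right-c.e. quasi-metric spaces\<close>

locale quasi_metric =
  fixes X :: "'a set" and d :: "'a \<Rightarrow> 'a \<Rightarrow> real"
  assumes nonneg: "x \<in> X \<Longrightarrow> y \<in> X \<Longrightarrow> 0 \<le> d x y"
    and triangle: "x \<in> X \<Longrightarrow> y \<in> X \<Longrightarrow> z \<in> X \<Longrightarrow> d x z \<le> d x y + d y z"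
    and eq_iff: "x \<in> X \<Longrightarrow> y \<in> X \<Longrightarrow> x = y \<longleftrightarrow> d x y = 0 \<and> d y x = 0"

definition sym_dist :: "('a \<Rightarrow> 'a \<Rightarrow> real) \<Rightarrow> 'a \<Rightarrow> 'a \<Rightarrow> real" where
  "sym_dist d x y = max (d x y) (d y x)"

locale right_ce_quasi_metric_space = quasi_metric X d
  for X :: "'a set" and d :: "'a \<Rightarrow> 'a \<Rightarrow> real" +
  fixes S :: "nat \<Rightarrow> 'a"
  assumes S_in: "S i \<in> X"
    and dense: "x \<in> X \<Longrightarrow> 0 < e \<Longrightarrow> \<exists>i. sym_dist d (S i) x < e"
    and right_ce: "uniformly_right_ce (\<lambda>i j. d (S i) (S j))"

definition basic_ball :: "'a set \<Rightarrow> ('a \<Rightarrow> 'a \<Rightarrow> real) \<Rightarrow> (nat \<Rightarrow> 'a) \<Rightarrow> nat \<Rightarrow> 'a set" where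
  "basic_ball X d S n =
     (case prod_decode n of (i, k) \<Rightarrow> {x \<in> X. d (S i) x < real_of_rat (pos_rat_of_code k)})"


section \<open>Representations\<close>

text \<open>The partial map sending a name to the point it names; \<open>N p x\<close> means that \<open>p\<close> is a name
  of \<open>x\<close>.\<close>

definition rep_of :: "'a set \<Rightarrow> ((nat \<Rightarrow> nat) \<Rightarrow> 'a \<Rightarrow> bool) \<Rightarrow> (nat \<Rightarrow> nat) \<rightharpoonup> 'a" where
  "rep_of X N p =
     (if \<exists>!x. x \<in> X \<and> N p x then Some (THE x. x \<in> X \<and> N p x) else None)"

definition std_name :: "(nat \<Rightarrow> 'a set) \<Rightarrow> (nat \<Rightarrow> nat) \<Rightarrow> 'a \<Rightarrow> bool" where
  "std_name B p x \<longleftrightarrow> {n. \<exists>i. p i = n + 1} = {n. x \<in> B n}"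

definition std_rep :: "'a set \<Rightarrow> (nat \<Rightarrow> 'a set) \<Rightarrow> (nat \<Rightarrow> nat) \<rightharpoonup> 'a" where
  "std_rep X B = rep_of X (std_name B)"

definition cauchy_name ::
    "('a \<Rightarrow> 'a \<Rightarrow> real) \<Rightarrow> (nat \<Rightarrow> 'a) \<Rightarrow> (nat \<Rightarrow> nat) \<Rightarrow> 'a \<Rightarrow> bool" where
  "cauchy_name d S p x \<longleftrightarrow>
     (\<forall>n. d (S (p n)) (S (p (Suc n))) < 1 / 2 ^ n) \<and>
     (\<lambda>n. sym_dist d (S (p n)) x) \<longlonglongrightarrow> 0"

definition cauchy_rep ::
    "'a set \<Rightarrow> ('a \<Rightarrow> 'a \<Rightarrow> real) \<Rightarrow> (nat \<Rightarrow> 'a) \<Rightarrow> (nat \<Rightarrow> nat) \<rightharpoonup> 'a" where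
  "cauchy_rep X d S = rep_of X (cauchy_name d S)"

definition computably_reducible ::
    "((nat \<Rightarrow> nat) \<rightharpoonup> 'a) \<Rightarrow> ((nat \<Rightarrow> nat) \<rightharpoonup> 'a) \<Rightarrow> bool" where
  "computably_reducible \<delta> \<delta>' \<longleftrightarrow>
     (\<exists>F. partial_computable F \<and> (\<forall>p \<in> dom \<delta>. \<delta> p = (\<delta>' \<circ>\<^sub>m F) p))"

definition computably_equivalent ::
    "((nat \<Rightarrow> nat) \<rightharpoonup> 'a) \<Rightarrow> ((nat \<Rightarrow> nat) \<rightharpoonup> 'a) \<Rightarrow> bool" where
  "computably_equivalent \<delta> \<delta>' \<longleftrightarrow>
     computably_reducible \<delta> \<delta>' \<and> computably_reducible \<delta>' \<delta>"

text \<open>On a right-c.e. quasi-metric space a sequence names at most one point, so the uniqueness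
  clause in \<open>rep_of\<close> excludes no names.\<close>

lemma rep_of_eq_Some_iff:
  assumes "\<And>x y. x \<in> X \<Longrightarrow> y \<in> X \<Longrightarrow> N p x \<Longrightarrow> N p y \<Longrightarrow> x = y"
  shows "rep_of X N p = Some x \<longleftrightarrow> x \<in> X \<and> N p x"
proof
  assume "rep_of X N p = Some x"
  then have "\<exists>!x. x \<in> X \<and> N p x" and "x = (THE x. x \<in> X \<and> N p x)"
    by (auto simp: rep_of_def split: if_splits)
  then show "x \<in> X \<and> N p x" by (metis (mono_tags, lifting) theI')
next
  assume x: "x \<in> X \<and> N p x"
  then have "\<exists>!x. x \<in> X \<and> N p x" using assms by blast
  moreover have "(THE x. x \<in> X \<and> N p x) = x" using x assms by blast
  ultimately show "rep_of X N p = Some x" by (simp add: rep_of_def)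
qed

lemma pos_rat_of_code_surj:
  assumes "0 < r"
  shows "\<exists>k. pos_rat_of_code k = r"
proof -
  obtain a b where ab: "quotient_of r = (a, b)" by fastforce
  have b: "0 < b" using quotient_of_denom_pos[OF ab] .
  have r: "r = of_int a / of_int b" using quotient_of_div[OF ab] .
  then have a: "0 < a" using assms b by (simp add: zero_less_divide_iff)
  have "pos_rat_of_code (prod_encode (nat (a - 1), nat (b - 1))) = r"
    using a b by (simp add: pos_rat_of_code_def r Suc_nat_eq_nat_zadd1 del: of_nat_Suc)
  then show ?thesis by blast
qed

context right_ce_quasi_metric_space
begin

lemma cauchy_rep_eq_Some_iff: "cauchy_rep X d S p = Some x \<longleftrightarrow> x \<in> X \<and> cauchy_name d S p x"
  unfolding cauchy_rep_def
proof (rule rep_of_eq_Some_iff)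
  fix x y assume xy: "x \<in> X" "y \<in> X" and "cauchy_name d S p x" "cauchy_name d S p y"
  then have lim: "(\<lambda>n. sym_dist d (S (p n)) x + sym_dist d (S (p n)) y) \<longlonglongrightarrow> 0 + 0"
    by (intro tendsto_add) (auto simp: cauchy_name_def)
  have le: "u \<in> X \<Longrightarrow> v \<in> X \<Longrightarrow> d u v \<le> sym_dist d (S (p n)) u + sym_dist d (S (p n)) v"
    for u v n
    using triangle[of u "S (p n)" v] S_in[of "p n"] by (auto simp: sym_dist_def)
  have "d x y \<le> 0"
    by (rule LIMSEQ_le_const) (use lim le xy in auto)
  moreover have "d y x \<le> 0"
    by (rule LIMSEQ_le_const) (use lim le[of y x] xy in \<open>auto simp: add.commute\<close>)
  ultimately show "x = y"
    using nonneg eq_iff xy by (metis order_antisym)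
qed

lemma std_rep_eq_Some_iff:
  "std_rep X (basic_ball X d S) p = Some x \<longleftrightarrow> x \<in> X \<and> std_name (basic_ball X d S) p x"
  unfolding std_rep_def
proof (rule rep_of_eq_Some_iff)
  fix x y assume xy: "x \<in> X" "y \<in> X"
    and "std_name (basic_ball X d S) p x" "std_name (basic_ball X d S) p y"
  then have same: "x \<in> basic_ball X d S n \<longleftrightarrow> y \<in> basic_ball X d S n" for n
    by (auto simp: std_name_def)
  have "d u v \<le> 0"
    if uv: "u \<in> X" "v \<in> X"
      and same: "\<And>n. u \<in> basic_ball X d S n \<longleftrightarrow> v \<in> basic_ball X d S n" for u v
  proof (rule ccontr)
    assume "\<not> d u v \<le> 0"
    then obtain r where r: "0 < real_of_rat r" "real_of_rat r < d u v / 2"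
      using of_rat_dense[of 0 "d u v / 2"] by auto
    obtain k where k: "pos_rat_of_code k = r" using pos_rat_of_code_surj r by auto
    obtain i where i: "sym_dist d (S i) u < real_of_rat r" using dense uv r by blast
    then have "u \<in> basic_ball X d S (prod_encode (i, k))"
      using uv k by (simp add: basic_ball_def sym_dist_def)
    then have "v \<in> basic_ball X d S (prod_encode (i, k))" using same by blast
    then have "d (S i) v < real_of_rat r"
      using k by (simp add: basic_ball_def)
    then show False
      using triangle[of u "S i" v] uv S_in i r by (auto simp: sym_dist_def)
  qed
  then have "d x y \<le> 0" "d y x \<le> 0" using xy same by blast+
  then show "x = y"
    using nonneg eq_iff xy by (metis order_antisym)
qed

end

end

theory Submission
  imports Defs
begin

text \<open>
  From a Cauchy name \<open>t\<close> of \<open>x\<close> one gets \<open>d t\<^sub>n x \<le> 2 / 2^n\<close>, so the ball \<open>B(s\<^sub>i, r)\<close> contains \<open>x\<close> iff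
  \<open>d s\<^sub>i t\<^sub>n + 2 / 2^n < r\<close> for some \<open>n\<close>; for right-c.e. distances this can be enumerated.

  Conversely, from an enumeration \<open>p\<close> of all balls containing \<open>x\<close>, choose \<open>t\<^sub>n\<close> by search such that
  the ball \<open>B(t\<^sub>n, 2^-n)\<close> is enumerated and \<open>t\<^sub>n\<close> lies in all balls enumerated up to some stage. Letting
  this stage exceed both \<open>n\<close> and the place where \<open>B(t\<^sub>n\<^sub>-\<^sub>1, 2^-(n-1))\<close> was enumerated ensures the Cauchy
  condition; and since every ball around \<open>x\<close> is eventually taken into account, \<open>d x t\<^sub>n\<close> tends to \<open>0\<close>
  as well, although the name only bounds distances towards \<open>x\<close>.
\<close>

section \<open>Functions computable on a set of oracles\<close>

text \<open>Totality is required only for oracles in \<open>D\<close>. With \<open>D\<close> the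
  domain of a representation, a search that halts merely on genuine names still counts as
  computable.\<close>

definition computable_on :: "(nat \<Rightarrow> nat) set \<Rightarrow> ((nat \<Rightarrow> nat) \<Rightarrow> nat \<Rightarrow> nat) \<Rightarrow> bool" where
  "computable_on D f \<longleftrightarrow> (\<exists>e. \<forall>p\<in>D. \<forall>x. run e p x = Some (f p x))"

abbreviation decidable_on :: "(nat \<Rightarrow> nat) set \<Rightarrow> ((nat \<Rightarrow> nat) \<Rightarrow> nat \<Rightarrow> bool) \<Rightarrow> bool" where
  "decidable_on D P \<equiv> computable_on D (\<lambda>p x. of_bool (P p x))"

abbreviation pi1 :: "nat \<Rightarrow> nat" where "pi1 x \<equiv> fst (prod_decode x)"
abbreviation pi2 :: "nat \<Rightarrow> nat" where "pi2 x \<equiv> snd (prod_decode x)"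

named_theorems computable_intros

lemma computable_on_cong:
  assumes "computable_on D f" "\<And>p x. p \<in> D \<Longrightarrow> f p x = g p x"
  shows "computable_on D g"
  using assms by (simp add: computable_on_def)

lemma computable_on_id [computable_intros]: "computable_on D (\<lambda>p x. x)"
  \<comment> \<open>The identity is no basic program; unpacking and repacking the pair yields
    it.\<close>
  unfolding computable_on_def by (rule exI[of _ "Tuple Proj1 Proj2"]) simp

lemma computable_on_const [computable_intros]: "computable_on D (\<lambda>p x. c)"
proof (induction c)
  case 0
  show ?case unfolding computable_on_def by (rule exI[of _ Zero]) simp
next
  case (Suc c)
  then obtain e where "\<forall>p\<in>D. \<forall>x. run e p x = Some c" unfolding computable_on_def by blast
  then show ?case unfolding computable_on_def by (intro exI[of _ "Comp Succ e"]) simp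
qed

lemma computable_on_Suc [computable_intros]:
  assumes "computable_on D f" shows "computable_on D (\<lambda>p x. Suc (f p x))"
proof -
  obtain e where "\<forall>p\<in>D. \<forall>x. run e p x = Some (f p x)"
    using assms unfolding computable_on_def by blast
  then show ?thesis unfolding computable_on_def by (intro exI[of _ "Comp Succ e"]) simp
qed

lemma computable_on_pi1 [computable_intros]:
  assumes "computable_on D f" shows "computable_on D (\<lambda>p x. pi1 (f p x))"
proof -
  obtain e where "\<forall>p\<in>D. \<forall>x. run e p x = Some (f p x)"
    using assms unfolding computable_on_def by blast
  then show ?thesis unfolding computable_on_def by (intro exI[of _ "Comp Proj1 e"]) simp
qed

lemma computable_on_pi2 [computable_intros]:
  assumes "computable_on D f" shows "computable_on D (\<lambda>p x. pi2 (f p x))"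
proof -
  obtain e where "\<forall>p\<in>D. \<forall>x. run e p x = Some (f p x)"
    using assms unfolding computable_on_def by blast
  then show ?thesis unfolding computable_on_def by (intro exI[of _ "Comp Proj2 e"]) simp
qed

lemma computable_on_oracle [computable_intros]:
  assumes "computable_on D f" shows "computable_on D (\<lambda>p x. p (f p x))"
proof -
  obtain e where "\<forall>p\<in>D. \<forall>x. run e p x = Some (f p x)"
    using assms unfolding computable_on_def by blast
  then show ?thesis unfolding computable_on_def by (intro exI[of _ "Comp Oracle e"]) simp
qed

lemma computable_on_prod_encode [computable_intros]:
  assumes "computable_on D f" "computable_on D g"
  shows "computable_on D (\<lambda>p x. prod_encode (f p x, g p x))"
proof -
  obtain e e' where "\<forall>p\<in>D. \<forall>x. run e p x = Some (f p x)" "\<forall>p\<in>D. \<forall>x. run e' p x = Some (g p x)"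
    using assms unfolding computable_on_def by blast
  then show ?thesis unfolding computable_on_def by (intro exI[of _ "Tuple e e'"]) simp
qed

lemma computable_on_comp:
  assumes "computable f" "computable_on D g"
  shows "computable_on D (\<lambda>p x. f (g p x))"
proof -
  obtain e e' where "\<forall>p x. run e p x = Some (f x)" "\<forall>p\<in>D. \<forall>x. run e' p x = Some (g p x)"
    using assms unfolding computable_on_def computable_def by blast
  then show ?thesis unfolding computable_on_def by (intro exI[of _ "Comp e e'"]) simp
qed

text \<open>The step function may use the parameter \<open>x\<close>. Its program reads one number
  \<open>y\<close> coding \<open>(x, (m, r))\<close>, the layout that \<open>PrimRec\<close> hands
  over; hence the projections in the third assumption.\<close>

lemma computable_on_rec_nat [computable_intros]:
  assumes "computable_on D f" "computable_on D h"
    and "computable_on D (\<lambda>p y. g p (pi1 y) (pi1 (pi2 y)) (pi2 (pi2 y)))"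
  shows "computable_on D (\<lambda>p x. rec_nat (f p x) (g p x) (h p x))"
proof -
  obtain e e' e'' where e: "\<forall>p\<in>D. \<forall>x. run e p x = Some (f p x)"
    "\<forall>p\<in>D. \<forall>x. run e' p x = Some (h p x)"
    "\<forall>p\<in>D. \<forall>y. run e'' p y = Some (g p (pi1 y) (pi1 (pi2 y)) (pi2 (pi2 y)))"
    using assms unfolding computable_on_def by blast
  have "rec_nat (run e p x)
          (\<lambda>m r. Option.bind r (\<lambda>v. run e'' p (prod_encode (x, prod_encode (m, v))))) n
        = Some (rec_nat (f p x) (g p x) n)" if "p \<in> D" for p x n
    using that e by (induction n) simp_all
  then have "\<forall>p\<in>D. \<forall>x. run (Comp (PrimRec e e'') (Tuple (Tuple Proj1 Proj2) e')) p x
      = Some (rec_nat (f p x) (g p x) (h p x))"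
    using e by simp
  then show ?thesis unfolding computable_on_def by blast
qed

section \<open>Primitive recursive arithmetic\<close>

lemma computable_on_pred [computable_intros]:
  assumes "computable_on D f" shows "computable_on D (\<lambda>p x. f p x - 1)"
proof (rule computable_on_cong)
  show "computable_on D (\<lambda>p x. rec_nat 0 (\<lambda>m r. m) (f p x))"
    by (intro computable_intros assms)
  show "rec_nat 0 (\<lambda>m r. m) (f p x) = f p x - 1" for p x
    by (cases "f p x") simp_all
qed

lemma computable_on_add [computable_intros]:
  assumes "computable_on D f" "computable_on D g"
  shows "computable_on D (\<lambda>p x. f p x + g p x)"
proof (rule computable_on_cong)
  show "computable_on D (\<lambda>p x. rec_nat (f p x) (\<lambda>m r. Suc r) (g p x))"
    by (intro computable_intros assms)
  have "rec_nat a (\<lambda>m r. Suc r) b = a + b" for a b by (induction b) simp_all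
  then show "rec_nat (f p x) (\<lambda>m r. Suc r) (g p x) = f p x + g p x" for p x .
qed

lemma computable_on_diff [computable_intros]:
  assumes "computable_on D f" "computable_on D g"
  shows "computable_on D (\<lambda>p x. f p x - g p x)"
proof (rule computable_on_cong)
  show "computable_on D (\<lambda>p x. rec_nat (f p x) (\<lambda>m r. r - 1) (g p x))"
    by (intro computable_intros assms)
  have "rec_nat a (\<lambda>m r. r - 1) b = a - b" for a b :: nat by (induction b) simp_all
  then show "rec_nat (f p x) (\<lambda>m r. r - 1) (g p x) = f p x - g p x" for p x .
qed

lemma computable_on_mult [computable_intros]:
  assumes "computable_on D f" "computable_on D g"
  shows "computable_on D (\<lambda>p x. f p x * g p x)"
proof (rule computable_on_cong)
  \<comment> \<open>The step adds \<open>f p x\<close>, so \<open>x\<close> has to be recovered from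
    the packed argument of the recursion.\<close>
  have "computable_on D (\<lambda>p y. f p (pi1 y))"
  proof -
    obtain e where "\<forall>p\<in>D. \<forall>x. run e p x = Some (f p x)"
      using assms unfolding computable_on_def by blast
    then show ?thesis unfolding computable_on_def by (intro exI[of _ "Comp e Proj1"]) simp
  qed
  then show "computable_on D (\<lambda>p x. rec_nat 0 (\<lambda>m r. r + f p x) (g p x))"
    by (intro computable_intros assms)
  have "rec_nat 0 (\<lambda>m r. r + a) b = a * b" for a b :: nat by (induction b) simp_all
  then show "rec_nat 0 (\<lambda>m r. r + f p x) (g p x) = f p x * g p x" for p x .
qed

lemma computable_on_power2 [computable_intros]:
  assumes "computable_on D f" shows "computable_on D (\<lambda>p x. 2 ^ f p x)"
proof (rule computable_on_cong)
  show "computable_on D (\<lambda>p x. rec_nat 1 (\<lambda>m r. 2 * r) (f p x))"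
    by (intro computable_intros assms)
  have "rec_nat 1 (\<lambda>m r. 2 * r) b = 2 ^ b" for b :: nat by (induction b) simp_all
  then show "rec_nat 1 (\<lambda>m r. 2 * r) (f p x) = 2 ^ f p x" for p x .
qed

lemma computable_on_div2 [computable_intros]:
  assumes "computable_on D f" shows "computable_on D (\<lambda>p x. f p x div 2)"
proof (rule computable_on_cong)
  show "computable_on D (\<lambda>p x. rec_nat 0 (\<lambda>m r. m - r) (f p x))"
    by (intro computable_intros assms)
  \<comment> \<open>Halving by recursion works since
    \<open>Suc b div 2 = b - b div 2\<close>.\<close>
  have "rec_nat 0 (\<lambda>m r. m - r) b = b div 2" for b :: nat
  proof (induction b)
    case (Suc b)
    then show ?case by simp
  qed simp
  then show "rec_nat 0 (\<lambda>m r. m - r) (f p x) = f p x div 2" for p x .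
qed

section \<open>Decidable relations, bounded quantifiers and unbounded search\<close>

lemma decidable_on_less [computable_intros]:
  assumes "computable_on D f" "computable_on D g"
  shows "decidable_on D (\<lambda>p x. f p x < g p x)"
  \<comment> \<open>Subtraction is truncated: \<open>Suc (f p x) - g p x\<close> is 0 exactly when
    \<open>f p x < g p x\<close>.\<close>
  by (rule computable_on_cong[of D "\<lambda>p x. 1 - (Suc (f p x) - g p x)"])
     (intro computable_intros assms, auto)

lemma decidable_on_not [computable_intros]:
  assumes "decidable_on D P"
  shows "decidable_on D (\<lambda>p x. \<not> P p x)"
  by (rule computable_on_cong[of D "\<lambda>p x. 1 - of_bool (P p x)"])
     (intro computable_intros assms, auto)

lemma decidable_on_conj [computable_intros]:
  assumes "decidable_on D P" "decidable_on D Q"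
  shows "decidable_on D (\<lambda>p x. P p x \<and> Q p x)"
  by (rule computable_on_cong[of D "\<lambda>p x. of_bool (P p x) * of_bool (Q p x)"])
     (intro computable_intros assms, auto)

lemma decidable_on_disj [computable_intros]:
  assumes "decidable_on D P" "decidable_on D Q"
  shows "decidable_on D (\<lambda>p x. P p x \<or> Q p x)"
  by (rule computable_on_cong[of D "\<lambda>p x. of_bool (\<not> (\<not> P p x \<and> \<not> Q p x))"])
     (intro computable_intros assms, auto)

lemma decidable_on_eq [computable_intros]:
  assumes "computable_on D f" "computable_on D g"
  shows "decidable_on D (\<lambda>p x. f p x = g p x)"
  by (rule computable_on_cong[of D "\<lambda>p x. of_bool (\<not> f p x < g p x \<and> \<not> g p x < f p x)"])
     (intro computable_intros assms, auto)

lemma computable_on_if [computable_intros]: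
  assumes "decidable_on D P" "computable_on D f" "computable_on D g"
  shows "computable_on D (\<lambda>p x. if P p x then f p x else g p x)"
  by (rule computable_on_cong
        [of D "\<lambda>p x. of_bool (P p x) * f p x + of_bool (\<not> P p x) * g p x"])
     (intro computable_intros assms, auto)

text \<open>A bounded universal quantifier is the product of its truth values, formed by recursion
  on the bound.\<close>

lemma decidable_on_all_less [computable_intros]:
  assumes "computable_on D h" "decidable_on D (\<lambda>p y. P p (pi1 y) (pi2 y))"
  shows "decidable_on D (\<lambda>p x. \<forall>l<h p x. P p x l)"
proof (rule computable_on_cong)
  have "decidable_on D (\<lambda>p y. P p (pi1 y) (pi1 (pi2 y)))"
  proof -
    obtain e where "\<forall>p\<in>D. \<forall>y. run e p y = Some (of_bool (P p (pi1 y) (pi2 y)))"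
      using assms(2) unfolding computable_on_def by blast
    then show ?thesis unfolding computable_on_def
      by (intro exI[of _ "Comp e (Tuple Proj1 (Comp Proj1 Proj2))"]) simp
  qed
  then show "computable_on D (\<lambda>p x. rec_nat 1 (\<lambda>m r. r * of_bool (P p x m)) (h p x))"
    by (intro computable_intros assms)
  have "rec_nat 1 (\<lambda>m r. r * of_bool (Q m)) b = (of_bool (\<forall>l<b. Q l) :: nat)" for Q b
    by (induction b) (auto simp: less_Suc_eq)
  then show "rec_nat 1 (\<lambda>m r. r * of_bool (P p x m)) (h p x)
      = (of_bool (\<forall>l<h p x. P p x l) :: nat)" for p x .
qed

lemma decidable_on_ex_less [computable_intros]:
  assumes "computable_on D h" "decidable_on D (\<lambda>p y. P p (pi1 y) (pi2 y))"
  shows "decidable_on D (\<lambda>p x. \<exists>l<h p x. P p x l)"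
  by (rule computable_on_cong[of D "\<lambda>p x. of_bool (\<not> (\<forall>l<h p x. \<not> P p x l))"])
     (intro computable_intros assms, auto)

text \<open>\<open>Mu\<close> looks for the first zero, so it is run on the negation of
  \<open>P\<close>. Decidability makes all earlier values defined, and the existence assumption
  makes the search halt for every oracle in \<open>D\<close>.\<close>

lemma computable_on_Least:
  assumes "\<And>p x. p \<in> D \<Longrightarrow> \<exists>n. P p x n" "decidable_on D (\<lambda>p y. P p (pi1 y) (pi2 y))"
  shows "computable_on D (\<lambda>p x. LEAST n. P p x n)"
proof -
  have "decidable_on D (\<lambda>p y. \<not> P p (pi1 y) (pi2 y))"
    by (intro computable_intros assms)
  then obtain e where e: "\<forall>p\<in>D. \<forall>y. run e p y = Some (of_bool (\<not> P p (pi1 y) (pi2 y)))"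
    unfolding computable_on_def by blast
  have "run (Mu e) p x = Some (LEAST n. P p x n)" if "p \<in> D" for p x
  proof -
    have "\<exists>n. P p x n \<and> (\<forall>m<n. \<not> P p x m)"
      using assms(1)[OF that] exists_least_iff[of "P p x"] by blast
    then show ?thesis using e that by (auto simp: minimise_def)
  qed
  then show ?thesis unfolding computable_on_def by blast
qed

text \<open>For nonnegative codes the numerator \<^term>\<open>int_decode a\<close> is just \<^term>\<open>a div 2\<close>.\<close>

lemma rat_of_code_nonneg:
  assumes "0 \<le> rat_of_code u"
  shows "rat_of_code u = of_nat (pi1 u div 2) / of_nat (Suc (pi2 u))"
proof -
  have "0 \<le> int_decode (pi1 u)"
  proof (rule ccontr)
    assume "\<not> 0 \<le> int_decode (pi1 u)"
    then have "rat_of_code u < 0"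
      by (simp add: rat_of_code_def case_prod_beta divide_less_0_iff del: of_nat_Suc)
    then show False using assms by simp
  qed
  then have "int_decode (pi1 u) = int (pi1 u div 2)"
    by (auto simp: int_decode_def sum_decode_def split: if_splits)
  then show ?thesis by (simp add: rat_of_code_def case_prod_beta)
qed

text \<open>Multiplying out the positive denominators leaves an inequality between natural numbers.
  Nonnegativity lets the numerator be found by halving, without integer arithmetic. The dyadic
  summand serves as slack.\<close>

lemma decidable_on_rat_of_code_less:
  assumes "computable_on D u" "computable_on D a" "computable_on D n" "computable_on D c"
    and nonneg: "\<And>p x. p \<in> D \<Longrightarrow> 0 \<le> rat_of_code (u p x)"
  shows "decidable_on D (\<lambda>p x. real_of_rat (rat_of_code (u p x)) + real (a p x) / 2 ^ n p x
           < real_of_rat (pos_rat_of_code (c p x)))"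
proof (rule computable_on_cong)
  let ?L = "\<lambda>u a n c. ((pi1 u div 2) * 2 ^ n + a * Suc (pi2 u)) * Suc (pi2 c)
             < Suc (pi1 c) * (Suc (pi2 u) * 2 ^ n)"
  show "decidable_on D (\<lambda>p x. ?L (u p x) (a p x) (n p x) (c p x))"
    by (intro computable_intros assms)
  fix p x assume "p \<in> D"
  have "?L u a n c \<longleftrightarrow> real_of_rat (rat_of_code u) + real a / 2 ^ n < real_of_rat (pos_rat_of_code c)"
    if "0 \<le> rat_of_code u" for u a n c
  proof -
    define v w z where "v = Suc (pi2 u)" and "w = Suc (pi2 c)" and "z = pi1 u div 2"
    have pos: "0 < real v" "0 < real w" by (simp_all add: v_def w_def)
    have "real_of_rat (rat_of_code u) = real z / real v"
      unfolding rat_of_code_nonneg[OF that] v_def z_def by (simp only: of_rat_divide of_rat_of_nat_eq)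
    moreover have "real_of_rat (pos_rat_of_code c) = real (Suc (pi1 c)) / real w"
      unfolding pos_rat_of_code_def case_prod_beta w_def by (simp only: of_rat_divide of_rat_of_nat_eq)
    moreover have "real z / real v + real a / 2 ^ n = (real z * 2 ^ n + real a * real v) / (real v * 2 ^ n)"
      using pos by (simp add: add_frac_eq)
    moreover have "\<dots> < real (Suc (pi1 c)) / real w \<longleftrightarrow>
        (real z * 2 ^ n + real a * real v) * real w < real (Suc (pi1 c)) * (real v * 2 ^ n)"
      using pos by (simp add: frac_less_eq divide_less_eq less_divide_eq mult_ac del: of_nat_Suc)
    moreover have "\<dots> \<longleftrightarrow> real ((z * 2 ^ n + a * v) * w) < real (Suc (pi1 c) * (v * 2 ^ n))"
      by (simp del: of_nat_Suc mult_Suc)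
    moreover have "\<dots> \<longleftrightarrow> (z * 2 ^ n + a * v) * w < Suc (pi1 c) * (v * 2 ^ n)"
      by (rule of_nat_less_iff)
    ultimately show ?thesis by (simp add: v_def w_def z_def)
  qed
  then show "of_bool (?L (u p x) (a p x) (n p x) (c p x)) = of_bool (real_of_rat (rat_of_code (u p x))
      + real (a p x) / 2 ^ n p x < real_of_rat (pos_rat_of_code (c p x)))"
    using nonneg[OF \<open>p \<in> D\<close>] by simp
qed

text \<open>Reducibility constrains values only on \<open>dom \<delta>\<close>, so the program for
  \<open>G\<close> serves as it stands, whatever its partial map does on other oracles.\<close>

lemma computably_reducibleI:
  assumes "computable_on (dom \<delta>) G" "\<And>p x. \<delta> p = Some x \<Longrightarrow> \<delta>' (G p) = Some x"
  shows "computably_reducible \<delta> \<delta>'"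
proof -
  obtain e where e: "\<forall>p\<in>dom \<delta>. \<forall>x. run e p x = Some (G p x)"
    using assms(1) unfolding computable_on_def by blast
  let ?F = "\<lambda>p. if \<forall>n. run e p n \<noteq> None then Some (\<lambda>n. the (run e p n)) else None"
  have "partial_computable ?F" unfolding partial_computable_def by blast
  moreover have "\<delta> p = (\<delta>' \<circ>\<^sub>m ?F) p" if p: "p \<in> dom \<delta>" for p
  proof -
    have "?F p = Some (G p)" using e p by simp
    moreover obtain x where "\<delta> p = Some x" using p by blast
    ultimately show ?thesis using assms(2) by (simp add: map_comp_def)
  qed
  ultimately show ?thesis unfolding computably_reducible_def by blast
qed

section \<open>Translating names\<close>

context right_ce_quasi_metric_space
begin

text \<open>An infimum lies below \<open>r\<close> iff some term does, so
  \<open>d (S i) (S j) < r\<close> has witnesses \<open>k\<close> that can be searched for. Taking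
  \<open>r = 0\<close> shows that no term is negative.\<close>

lemma obtain_upper_approximation:
  obtains f where "computable f"
    "\<And>i j k. 0 \<le> rat_of_code (f (prod_encode (i, prod_encode (j, k))))"
    "\<And>i j r. d (S i) (S j) < r \<longleftrightarrow>
       (\<exists>k. real_of_rat (rat_of_code (f (prod_encode (i, prod_encode (j, k))))) < r)"
proof -
  obtain f where f: "computable f" and inf: "\<And>i j.
      bdd_below (range (\<lambda>k. real_of_rat (rat_of_code (f (prod_encode (i, prod_encode (j, k)))))))
      \<and> d (S i) (S j) = (INF k. real_of_rat (rat_of_code (f (prod_encode (i, prod_encode (j, k))))))"
    using right_ce unfolding uniformly_right_ce_def Let_def by blast
  have less: "d (S i) (S j) < r \<longleftrightarrow>
       (\<exists>k. real_of_rat (rat_of_code (f (prod_encode (i, prod_encode (j, k))))) < r)" for i j r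
    using inf[of i j] by (simp add: cINF_less_iff)
  have "0 \<le> rat_of_code (f (prod_encode (i, prod_encode (j, k))))" for i j k
  proof -
    have "\<not> real_of_rat (rat_of_code (f (prod_encode (i, prod_encode (j, k))))) < 0"
      using less[of i j 0] nonneg[OF S_in S_in, of i j] by auto
    then show ?thesis by (simp add: not_less)
  qed
  with f less that show thesis by blast
qed

section \<open>From Cauchy names to standard names\<close>

text \<open>The steps from \<open>n\<close> on are bounded by a geometric series with sum
  \<open>2 / 2^n\<close>; convergence in the symmetrized distance carries the bound over to
  \<open>x\<close>.\<close>

lemma cauchy_name_dist_le:
  assumes x: "x \<in> X" and p: "cauchy_name d S p x"
  shows "d (S (p n)) x \<le> 2 / 2 ^ n"
proof -
  \<comment> \<open>The right side is the exact sum of the bounds \<open>1 / 2^k\<close> over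
    \<open>n \<le> k < n + m\<close>.\<close>
  have step: "d (S (p n)) (S (p (n + m))) \<le> 2 / 2 ^ n - 2 / 2 ^ (n + m)" for m
  proof (induction m)
    case 0
    show ?case using eq_iff[OF S_in S_in, of "p n" "p n"] by simp
  next
    case (Suc m)
    have "d (S (p (n + m))) (S (p (Suc (n + m)))) < 1 / 2 ^ (n + m)"
      using p by (simp add: cauchy_name_def)
    moreover have "2 / 2 ^ (n + m) - 1 / 2 ^ (n + m) = (2 / 2 ^ (n + Suc m) :: real)"
      by (simp add: field_simps)
    ultimately show ?case
      using Suc triangle[of "S (p n)" "S (p (n + m))" "S (p (Suc (n + m)))"] S_in by simp
  qed
  have "(\<lambda>m. sym_dist d (S (p (m + n))) x) \<longlonglongrightarrow> 0"
    using p LIMSEQ_ignore_initial_segment[of "\<lambda>m. sym_dist d (S (p m)) x"]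
    by (simp add: cauchy_name_def)
  then have "(\<lambda>m. 2 / 2 ^ n + sym_dist d (S (p (m + n))) x) \<longlonglongrightarrow> 2 / 2 ^ n + 0"
    by (intro tendsto_intros)
  moreover have "d (S (p n)) x \<le> 2 / 2 ^ n + sym_dist d (S (p (m + n))) x" for m
  proof -
    have "d (S (p n)) (S (p (m + n))) \<le> 2 / 2 ^ n"
      using step[of m] by (simp add: add.commute) (smt (verit) divide_nonneg_nonneg zero_le_power)
    then show ?thesis
      using triangle[OF S_in S_in x, of "p n" "p (m + n)"] by (auto simp: sym_dist_def)
  qed
  ultimately show ?thesis by (intro LIMSEQ_le_const[where a = "d (S (p n)) x"]) auto
qed

text \<open>The slack covers the distance from \<open>S (p n)\<close> to \<open>x\<close>, which
  gives one direction. For the other, symmetric convergence makes \<open>d x (S (p n))\<close>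
  vanish along with the slack, so a strict inequality at \<open>x\<close> survives at some
  \<open>n\<close>.\<close>

lemma cauchy_name_in_ball_iff:
  assumes x: "x \<in> X" and p: "cauchy_name d S p x"
  shows "d (S i) x < r \<longleftrightarrow> (\<exists>n. d (S i) (S (p n)) + 2 / 2 ^ n < r)"
proof
  assume "\<exists>n. d (S i) (S (p n)) + 2 / 2 ^ n < r"
  then obtain n where "d (S i) (S (p n)) + 2 / 2 ^ n < r" ..
  then show "d (S i) x < r"
    using triangle[OF S_in S_in x, of i "p n"] cauchy_name_dist_le[OF x p, of n] by simp
next
  assume less: "d (S i) x < r"
  have "(\<lambda>n. 2 * (1 / 2) ^ n :: real) \<longlonglongrightarrow> 2 * 0"
    by (intro tendsto_intros LIMSEQ_power_zero) simp
  then have "(\<lambda>n. 2 / 2 ^ n :: real) \<longlonglongrightarrow> 0" by (simp add: power_one_over)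
  moreover have "(\<lambda>n. sym_dist d (S (p n)) x) \<longlonglongrightarrow> 0" using p by (simp add: cauchy_name_def)
  ultimately have "(\<lambda>n. d (S i) x + sym_dist d (S (p n)) x + 2 / 2 ^ n) \<longlonglongrightarrow> d (S i) x + 0 + 0"
    by (intro tendsto_intros)
  then have "\<forall>\<^sub>F n in sequentially. d (S i) x + sym_dist d (S (p n)) x + 2 / 2 ^ n < r"
    by (rule order_tendstoD) (use less in simp)
  then obtain n where "d (S i) x + sym_dist d (S (p n)) x + 2 / 2 ^ n < r"
    using eventually_happens'[OF sequentially_bot] by blast
  moreover have "d (S i) (S (p n)) \<le> d (S i) x + sym_dist d (S (p n)) x"
    using triangle[OF S_in x S_in, of i "p n"] by (auto simp: sym_dist_def)
  ultimately show "\<exists>n. d (S i) (S (p n)) + 2 / 2 ^ n < r"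
    by (intro exI[of _ n]) simp
qed

lemma cauchy_rep_reducible_std_rep:
  "computably_reducible (cauchy_rep X d S) (std_rep X (basic_ball X d S))"
proof -
  obtain f where f: "computable f"
    "\<And>i j k. 0 \<le> rat_of_code (f (prod_encode (i, prod_encode (j, k))))"
    "\<And>i j r. d (S i) (S j) < r \<longleftrightarrow>
       (\<exists>k. real_of_rat (rat_of_code (f (prod_encode (i, prod_encode (j, k))))) < r)"
    using obtain_upper_approximation by blast
  define q where "q i j k = f (prod_encode (i, prod_encode (j, k)))" for i j k
  define T where "T p b n k \<longleftrightarrow> real_of_rat (rat_of_code (q (pi1 b) (p n) k)) + real 2 / 2 ^ n
      < real_of_rat (pos_rat_of_code (pi2 b))" for p b n k
  \<comment> \<open>The position \<open>y\<close> codes \<open>(b, (n, k))\<close>, so all candidate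
    witnesses are tried for all balls; a failed test outputs 0, which enumerates no ball.\<close>
  define G where "G p y = (if T p (pi1 y) (pi1 (pi2 y)) (pi2 (pi2 y)) then Suc (pi1 y) else 0)" for p y
  have "computable_on (dom (cauchy_rep X d S)) G"
    unfolding G_def T_def q_def
    by (intro computable_intros decidable_on_rat_of_code_less computable_on_comp[OF f(1)] f(2))
  moreover have "std_rep X (basic_ball X d S) (G p) = Some x" if "cauchy_rep X d S p = Some x" for p x
  proof -
    have x: "x \<in> X" and p: "cauchy_name d S p x" using that by (simp_all add: cauchy_rep_eq_Some_iff)
    have "(\<exists>y. G p y = b + 1) \<longleftrightarrow> x \<in> basic_ball X d S b" for b
    proof -
      have "(\<exists>y. G p y = b + 1) \<longleftrightarrow> (\<exists>n k. T p b n k)"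
      proof
        assume "\<exists>n k. T p b n k"
        then obtain n k where "T p b n k" by blast
        then have "G p (prod_encode (b, prod_encode (n, k))) = b + 1" by (simp add: G_def)
        then show "\<exists>y. G p y = b + 1" ..
      qed (auto simp: G_def split: if_splits)
      \<comment> \<open>With the slack moved to the right, \<open>f(3)\<close> absorbs the
        quantifier over \<open>k\<close>.\<close>
      also have "\<dots> \<longleftrightarrow> (\<exists>n. d (S (pi1 b)) (S (p n)) < real_of_rat (pos_rat_of_code (pi2 b)) - 2 / 2 ^ n)"
        unfolding f(3) T_def q_def by (simp add: less_diff_eq)
      also have "\<dots> \<longleftrightarrow> d (S (pi1 b)) x < real_of_rat (pos_rat_of_code (pi2 b))"
        unfolding cauchy_name_in_ball_iff[OF x p] by (simp add: less_diff_eq)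
      also have "\<dots> \<longleftrightarrow> x \<in> basic_ball X d S b"
        using x by (simp add: basic_ball_def case_prod_beta)
      finally show ?thesis .
    qed
    then show ?thesis using x by (simp add: std_rep_eq_Some_iff std_name_def)
  qed
  ultimately show ?thesis by (rule computably_reducibleI[where G = G])
qed

section \<open>From standard names to Cauchy names\<close>

text \<open>Each ball leaves a positive gap between its radius and the distance from its centre to
  \<open>x\<close>. A dense point closer to \<open>x\<close> than \<open>e\<close> and all of these
  finitely many gaps stays in every ball.\<close>

lemma ex_dense_point_in_balls:
  assumes x: "x \<in> X" and "finite B" "0 < e" "\<And>b. b \<in> B \<Longrightarrow> x \<in> basic_ball X d S b"
  obtains j where "sym_dist d (S j) x < e" "\<And>b. b \<in> B \<Longrightarrow> S j \<in> basic_ball X d S b"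
proof -
  define g where "g b = real_of_rat (pos_rat_of_code (pi2 b)) - d (S (pi1 b)) x" for b
  define e' where "e' = Min (insert e (g ` B))"
  have "0 < g b" if "b \<in> B" for b
    using assms(4)[OF that] by (simp add: g_def basic_ball_def case_prod_beta)
  then have "0 < e'" using assms by (simp add: e'_def)
  then obtain j where j: "sym_dist d (S j) x < e'" using dense x by blast
  have "e' \<le> e" and e': "\<And>b. b \<in> B \<Longrightarrow> e' \<le> g b" using assms by (simp_all add: e'_def)
  show thesis
  proof (rule that)
    show "sym_dist d (S j) x < e" using j \<open>e' \<le> e\<close> by simp
    show "S j \<in> basic_ball X d S b" if "b \<in> B" for b
      using e'[OF that] j triangle[OF S_in x S_in, of "pi1 b" j] S_in
      by (simp add: basic_ball_def case_prod_beta g_def sym_dist_def)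
  qed
qed

lemma std_rep_reducible_cauchy_rep:
  "computably_reducible (std_rep X (basic_ball X d S)) (cauchy_rep X d S)"
proof -
  let ?D = "dom (std_rep X (basic_ball X d S))"
  obtain f where f: "computable f"
    "\<And>i j k. 0 \<le> rat_of_code (f (prod_encode (i, prod_encode (j, k))))"
    "\<And>i j r. d (S i) (S j) < r \<longleftrightarrow>
       (\<exists>k. real_of_rat (rat_of_code (f (prod_encode (i, prod_encode (j, k))))) < r)"
    using obtain_upper_approximation by blast
  define q where "q i j k = f (prod_encode (i, prod_encode (j, k)))" for i j k
  \<comment> \<open>The zero slack gives the inequality the shape of
    \<open>decidable_on_rat_of_code_less\<close>.\<close>
  define T where "T b j k \<longleftrightarrow> real_of_rat (rat_of_code (q (pi1 b) j k)) + real 0 / 2 ^ 0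
      < real_of_rat (pos_rat_of_code (pi2 b))" for b j k
  have T: "S j \<in> basic_ball X d S b \<longleftrightarrow> (\<exists>k. T b j k)" for j b
    using S_in f(3) by (simp add: basic_ball_def case_prod_beta T_def q_def)
  define R where "R n = prod_encode (0, 2 ^ n - 1)" for n :: nat
  have R: "real_of_rat (pos_rat_of_code (R n)) = 1 / 2 ^ n" for n
    by (simp add: R_def pos_rat_of_code_def of_rat_divide of_rat_power del: of_nat_Suc)
  txt \<open>A stage \<open>w = (j, m, K)\<close> records the point \<open>S j\<close>, the place \<open>m\<close> where the ball of radius \<open>2^-n\<close>
    around it is enumerated, and a bound \<open>K\<close> on the witnesses. Only the component \<open>m\<close> of the previous
    stage \<open>v\<close> enters, so the search succeeds for every \<open>v\<close>, reachable or not.\<close>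
  define Q where "Q p n v w \<longleftrightarrow> p (pi1 (pi2 w)) = Suc (prod_encode (pi1 w, R n)) \<and>
      (\<forall>l<Suc (n + pi1 (pi2 v)). p l = 0 \<or> (\<exists>k<pi2 (pi2 w). T (p l - 1) (pi1 w) k))" for p n v w
  define next_stage where "next_stage p n v = (LEAST w. Q p n v w)" for p n v
  define stage where "stage p n = rec_nat 0 (next_stage p) n" for p n
  \<comment> \<open>\<open>stage p 0\<close> is only an arbitrary start, so output \<open>n\<close>
    is read from stage \<open>Suc n\<close>, whose search used the radius
    \<open>2^-n\<close>.\<close>
  define G where "G p n = pi1 (stage p (Suc n))" for p n

  have name: "(\<exists>i. p i = Suc b) \<longleftrightarrow> x \<in> basic_ball X d S b"
    if "std_rep X (basic_ball X d S) p = Some x" for p x b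
    using that by (auto simp: std_rep_eq_Some_iff std_name_def)
  have ex: "\<exists>w. Q p n v w" if p: "p \<in> ?D" for p n v
  proof -
    obtain x where x: "std_rep X (basic_ball X d S) p = Some x" using p by blast
    then have "x \<in> X" by (simp add: std_rep_eq_Some_iff)
    define N where "N = Suc (n + pi1 (pi2 v))"
    define B where "B = {b. \<exists>l<N. p l = Suc b}"
    have "B \<subseteq> (\<lambda>l. p l - 1) ` {..<N}" by (force simp: B_def)
    then have fin: "finite B" by (rule finite_subset) simp
    have "x \<in> basic_ball X d S b" if "b \<in> B" for b
      using that name[OF x, of b] by (auto simp: B_def)
    then obtain j where j: "sym_dist d (S j) x < 1 / 2 ^ n" "\<And>b. b \<in> B \<Longrightarrow> S j \<in> basic_ball X d S b"
      using ex_dense_point_in_balls[OF \<open>x \<in> X\<close> fin, of "1 / 2 ^ n"] by auto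
    have "x \<in> basic_ball X d S (prod_encode (j, R n))"
      using j(1) \<open>x \<in> X\<close> by (simp add: basic_ball_def R sym_dist_def)
    then obtain m where m: "p m = Suc (prod_encode (j, R n))" using name[OF x] by blast
    obtain k where k: "\<And>b. b \<in> B \<Longrightarrow> T b j (k b)" using j(2) T by metis
    \<comment> \<open>Only finitely many balls are inspected, so one bound exceeds all chosen
      witnesses; the inserted 0 covers empty \<open>B\<close>.\<close>
    define K where "K = Suc (Max (insert 0 (k ` B)))"
    have K: "k b < K" if "b \<in> B" for b
      using that fin by (simp add: K_def less_Suc_eq_le)
    have "p l = 0 \<or> (\<exists>k<K. T (p l - 1) j k)" if "l < N" for l
    proof (cases "p l")
      case (Suc b)
      then have "b \<in> B" using that by (auto simp: B_def)
      then show ?thesis using k K Suc by auto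
    qed simp
    then have "Q p n v (prod_encode (j, prod_encode (m, K)))"
      using m by (simp add: Q_def N_def)
    then show ?thesis ..
  qed
  \<comment> \<open>Here \<open>pi1 y\<close> packs the recursion parameter with \<open>n\<close>
    and \<open>v\<close>, and \<open>pi2 y\<close> is the candidate \<open>w\<close>.\<close>
  have "decidable_on ?D (\<lambda>p y. Q p (pi1 (pi2 (pi1 y))) (pi2 (pi2 (pi1 y))) (pi2 y))"
    unfolding Q_def T_def q_def R_def
    by (intro computable_intros decidable_on_rat_of_code_less computable_on_comp[OF f(1)] f(2))
  then have "computable_on ?D (\<lambda>p y. next_stage p (pi1 (pi2 y)) (pi2 (pi2 y)))"
    unfolding next_stage_def
    by (intro computable_on_Least[where P = "\<lambda>p y. Q p (pi1 (pi2 y)) (pi2 (pi2 y))"] ex)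
  then have "computable_on ?D G"
    unfolding G_def stage_def
    by (intro computable_intros)
  moreover have "cauchy_rep X d S (G p) = Some x" if x: "std_rep X (basic_ball X d S) p = Some x" for p x
  proof -
    have "x \<in> X" using x by (simp add: std_rep_eq_Some_iff)
    have "p \<in> ?D" using x by blast
    have "stage p (Suc n) = (LEAST w. Q p n (stage p n) w)" for n
      by (simp add: stage_def next_stage_def)
    then have Q: "Q p n (stage p n) (stage p (Suc n))" for n
      using LeastI_ex[OF ex[OF \<open>p \<in> ?D\<close>]] by simp
    define m where "m n = pi1 (pi2 (stage p n))" for n
    have m: "p (m (Suc n)) = Suc (prod_encode (G p n, R n))" for n
      using Q[of n] by (simp add: Q_def G_def m_def)
    have seen: "S (G p n) \<in> basic_ball X d S b" if "l \<le> n + m n" "p l = Suc b" for n l b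
    proof -
      have "l < Suc (n + pi1 (pi2 (stage p n)))" using that by (simp add: m_def)
      then have "\<exists>k. T b (G p n) k" using Q[of n] that(2) unfolding Q_def G_def by fastforce
      then show ?thesis by (simp add: T)
    qed
    \<comment> \<open>The ball of radius \<open>2^-n\<close> around point \<open>n\<close> stands at
      place \<open>m (Suc n)\<close>, which the search for point \<open>n + 1\<close> already
      inspects.\<close>
    have "d (S (G p n)) (S (G p (Suc n))) < 1 / 2 ^ n" for n
      using seen[OF _ m, of n "Suc n"] by (simp add: basic_ball_def R)
    moreover have "(\<lambda>n. sym_dist d (S (G p n)) x) \<longlonglongrightarrow> 0"
    proof (rule LIMSEQ_I)
      fix e :: real assume "0 < e"
      then obtain r where r: "0 < real_of_rat r" "real_of_rat r < e / 2"
        using of_rat_dense[of 0 "e / 2"] by auto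
      obtain c where c: "pos_rat_of_code c = r" using pos_rat_of_code_surj r by auto
      \<comment> \<open>This ball of radius below \<open>e / 2\<close> around a centre near
        \<open>x\<close> controls \<open>d x (S (G p n))\<close>: once its place \<open>l\<close> is
        inspected, both legs through \<open>S i\<close> are shorter than
        \<open>e / 2\<close>.\<close>
      obtain i where i: "sym_dist d (S i) x < real_of_rat r" using dense \<open>x \<in> X\<close> r by blast
      then have "x \<in> basic_ball X d S (prod_encode (i, c))"
        using \<open>x \<in> X\<close> c by (simp add: basic_ball_def sym_dist_def)
      then obtain l where l: "p l = Suc (prod_encode (i, c))" using name[OF x] by blast
      obtain n0 where n0: "(1 / 2) ^ n0 < e" using real_arch_pow_inv[OF \<open>0 < e\<close>, of "1 / 2"] by auto
      have "norm (sym_dist d (S (G p n)) x - 0) < e" if n: "n \<ge> max l n0" for n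
      proof -
        have "d (S i) (S (G p n)) < real_of_rat r"
          using seen[OF _ l, of n] n c by (simp add: basic_ball_def)
        then have 1: "d x (S (G p n)) < e"
          using triangle[of x "S i" "S (G p n)"] \<open>x \<in> X\<close> S_in i r by (simp add: sym_dist_def)
        \<comment> \<open>The opposite distance is bounded because every enumerated ball contains
          \<open>x\<close>.\<close>
        have "x \<in> basic_ball X d S (prod_encode (G p n, R n))" using m name[OF x] by blast
        then have "d (S (G p n)) x < (1 / 2) ^ n" by (simp add: basic_ball_def R power_one_over)
        also have "\<dots> \<le> (1 / 2) ^ n0" using n by (intro power_decreasing) auto
        finally have "d (S (G p n)) x < e" using n0 by simp
        then show ?thesis
          using 1 nonneg[OF \<open>x \<in> X\<close> S_in, of "G p n"] by (simp add: sym_dist_def)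
      qed
      then show "\<exists>no. \<forall>n\<ge>no. norm (sym_dist d (S (G p n)) x - 0) < e" by blast
    qed
    ultimately show ?thesis
      using \<open>x \<in> X\<close> by (simp add: cauchy_rep_eq_Some_iff cauchy_name_def)
  qed
  ultimately show ?thesis by (rule computably_reducibleI[where G = G])
qed

end

theorem theorem4:
  fixes X :: "'a set" and d :: "'a \<Rightarrow> 'a \<Rightarrow> real" and S :: "nat \<Rightarrow> 'a"
  assumes "right_ce_quasi_metric_space X d S"
  shows "computably_equivalent (cauchy_rep X d S) (std_rep X (basic_ball X d S))"
  unfolding computably_equivalent_def
  using right_ce_quasi_metric_space.cauchy_rep_reducible_std_rep[OF assms]
    right_ce_quasi_metric_space.std_rep_reducible_cauchy_rep[OF assms] by blast

end
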